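(* Let $D\in\mathbb{R}^{m\times n}$ be an arbitrary matrix and let $y\sim N(\mu,\sigma^2 I)$ in $\mathbb{R}^n$ with $\sigma>0$. Fix $\lambda\ge0$ and let $\hat\beta_\lambda=\hat\beta_\lambda(y)$ be the solution of the signal approximation problem $$\min_{\beta\in\mathbb{R}^n}\ \tfrac12\|y-\beta\|_2^2+\lambda\|D\beta\|_1 .$$ Then $\hat\beta_\lambda$ has degrees of freedom $$\operatorname{df}(\hat\beta_\lambda)=\mathrm{E}\big[\operatorname{nullity}(D_{-\mathcal{B}(y)})\big],$$ where the expectation is taken over $\mathcal{B}(y)$, the boundary set of a dual solution $\hat u_\lambda(y)$. (Any dual solution at $y$ may be used to construct $\mathcal{B}(y)$: the space $\operatorname{null}(D_{-\mathcal{B}(y)})$ does not depend on this choice for almost every $y$.)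
   Context: Degrees of freedom: for $g:\mathbb{R}^n\to\mathbb{R}^n$ with coordinate functions $g_i$ and $y\sim N(\mu,\sigma^2I)$, $\operatorname{df}(g)=\frac{1}{\sigma^2}\sum_{i=1}^n\operatorname{Cov}(g_i(y),y_i)$; here $g(y)=\hat\beta_\lambda(y)$. A dual solution $\hat u_\lambda(y)$ is any minimizer over $u\in\mathbb{R}^m$ of $\tfrac12\|y-D^Tu\|_2^2$ subject to $\|u\|_\infty\le\lambda$; it may not be unique. Boundary set: $\mathcal{B}(y)=\{i\in\{1,\dots,m\}: |\hat u_{\lambda,i}(y)|=\lambda\}$. $D_{-\mathcal{B}}$ is the matrix formed by the rows of $D$ whose indices are not in $\mathcal{B}$ (if there are no such rows, its null space is all of $\mathbb{R}^n$). The nullity of a matrix is the dimension of its null space. *)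

theory Defs
  imports "HOL-Probability.Probability"
begin

definition objective :: "real^'n^'m \<Rightarrow> real \<Rightarrow> real^'n \<Rightarrow> real^'n \<Rightarrow> real" where
  "objective D lam y b = 1/2 * (norm (y - b))\<^sup>2 + lam * (\<Sum>i\<in>UNIV. \<bar>(D *v b) $ i\<bar>)"

definition signal_approx :: "real^'n^'m \<Rightarrow> real \<Rightarrow> real^'n \<Rightarrow> real^'n" where
  "signal_approx D lam y = (THE b. is_arg_min (objective D lam y) (\<lambda>_. True) b)"

definition dual_solution :: "real^'n^'m \<Rightarrow> real \<Rightarrow> real^'n \<Rightarrow> real^'m \<Rightarrow> bool" where
  "dual_solution D lam y u \<longleftrightarrow>
     is_arg_min (\<lambda>v. 1/2 * (norm (y - transpose D *v v))\<^sup>2) (\<lambda>v. infnorm v \<le> lam) u"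

definition boundary_set :: "real \<Rightarrow> real^'m \<Rightarrow> 'm set" where
  "boundary_set lam u = {i. \<bar>u $ i\<bar> = lam}"

(* The null space and nullity of the matrix D_{-B} formed by the rows of D with index outside B.
   Its number of rows depends on B, so D_{-B} is not itself an element of a type real^'n^'k;
   D_{-B} x is the family of the row i D \<bullet> x over i \<notin> B. *)
definition null_space_minus :: "real^'n^'m \<Rightarrow> 'm set \<Rightarrow> (real^'n) set" where
  "null_space_minus D B = {x. \<forall>i. i \<notin> B \<longrightarrow> row i D \<bullet> x = 0}"

definition nullity_minus :: "real^'n^'m \<Rightarrow> 'm set \<Rightarrow> nat" where
  "nullity_minus D B = dim (null_space_minus D B)"

definition isotropic_normal_density :: "real^'n \<Rightarrow> real \<Rightarrow> real^'n \<Rightarrow> real" where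
  "isotropic_normal_density \<mu> \<sigma> y = (\<Prod>i\<in>UNIV. normal_density (\<mu> $ i) \<sigma> (y $ i))"

definition covariance :: "'a measure \<Rightarrow> ('a \<Rightarrow> real) \<Rightarrow> ('a \<Rightarrow> real) \<Rightarrow> real" where
  "covariance M X Z =
     (\<integral>\<omega>. (X \<omega> - (\<integral>\<omega>. X \<omega> \<partial>M)) * (Z \<omega> - (\<integral>\<omega>. Z \<omega> \<partial>M)) \<partial>M)"

definition degrees_of_freedom ::
    "'a measure \<Rightarrow> ('a \<Rightarrow> real^'n) \<Rightarrow> real \<Rightarrow> (real^'n \<Rightarrow> real^'n) \<Rightarrow> real" where
  "degrees_of_freedom M Y \<sigma> g =
     1 / \<sigma>\<^sup>2 * (\<Sum>i\<in>UNIV. covariance M (\<lambda>\<omega>. g (Y \<omega>) $ i) (\<lambda>\<omega>. Y \<omega> $ i))"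

lemma dual_solution_exists:
  fixes D :: "real^'n^'m"
  assumes "0 \<le> lam"
  shows "\<exists>u. dual_solution D lam y u"
proof -
  let ?S = "{v :: real^'m. infnorm v \<le> lam}"
  have "closed ?S"
    by (intro closed_Collect_le continuous_intros continuous_on_infnorm)
  moreover have "bounded ?S"
  proof (rule boundedI)
    fix v :: "real^'m" assume "v \<in> ?S"
    then show "norm v \<le> sqrt DIM(real^'m) * lam"
      using norm_le_infnorm[of v] by (smt (verit) mem_Collect_eq mult_left_mono real_sqrt_ge_zero of_nat_0_le_iff)
  qed
  ultimately have "compact ?S" by (simp add: compact_eq_bounded_closed)
  moreover have "0 \<in> ?S" using assms by (simp add: infnorm_0)
  then have "?S \<noteq> {}" by blast
  moreover have "continuous_on ?S (\<lambda>v. 1/2 * (norm (y - transpose D *v v))\<^sup>2)"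
    by (intro continuous_intros linear_continuous_on linear_conv_bounded_linear[THEN iffD1] matrix_vector_mul_linear)
  ultimately obtain u where "u \<in> ?S"
    "\<forall>v\<in>?S. 1/2 * (norm (y - transpose D *v u))\<^sup>2 \<le> 1/2 * (norm (y - transpose D *v v))\<^sup>2"
    using continuous_attains_inf[of ?S] by blast
  then have "dual_solution D lam y u"
    unfolding dual_solution_def is_arg_min_def by (simp add: not_less)
  then show ?thesis by blast
qed

lemma signal_approx_ex1:
  fixes D :: "real^'n^'m"
  assumes "0 \<le> lam"
  shows "\<exists>!b. is_arg_min (objective D lam y) (\<lambda>_. True) b"
proof -
  let ?f = "objective D lam y"
  have cont: "continuous_on S ?f" for S
    unfolding objective_def
    by (intro continuous_intros linear_continuous_on linear_conv_bounded_linear[THEN iffD1] matrix_vector_mul_linear)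
  define r where "r = sqrt (2 * ?f y)"
  have fy: "0 \<le> ?f y" using assms by (simp add: objective_def sum_nonneg)
  have "compact (cball y r)" "cball y r \<noteq> {}" using fy by (auto simp: r_def)
  then obtain b where b: "b \<in> cball y r" "\<forall>c\<in>cball y r. ?f b \<le> ?f c"
    using continuous_attains_inf[OF _ _ cont] by blast
  have y: "y \<in> cball y r" using fy by (simp add: r_def)
  have "?f b \<le> ?f c" for c
  proof (cases "c \<in> cball y r")
    case False
    then have "r \<le> norm (y - c)" by (simp add: dist_norm)
    moreover have "0 \<le> r" using fy by (simp add: r_def)
    ultimately have "r\<^sup>2 \<le> (norm (y - c))\<^sup>2" by (intro power_mono)
    then have "?f y \<le> 1/2 * (norm (y - c))\<^sup>2" using fy by (simp add: r_def)
    also have "\<dots> \<le> ?f c" using assms by (simp add: objective_def sum_nonneg)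
    finally show ?thesis using b y by fastforce
  qed (use b in blast)
  then have ex: "is_arg_min ?f (\<lambda>_. True) b"
    unfolding is_arg_min_def by (simp add: not_less)
  moreover have "c = d" if c: "is_arg_min ?f (\<lambda>_. True) c" and d: "is_arg_min ?f (\<lambda>_. True) d" for c d
  proof (rule ccontr)
    assume "c \<noteq> d"
    let ?m = "(1/2) *\<^sub>R (c + d)"
    have le: "?f c \<le> ?f ?m" "?f d \<le> ?f ?m"
      using c d unfolding is_arg_min_def by (auto simp: not_less)
    have "\<bar>(D *v ?m) $ i\<bar> \<le> 1/2 * \<bar>(D *v c) $ i\<bar> + 1/2 * \<bar>(D *v d) $ i\<bar>" for i
      by (simp add: matrix_vector_mult_scaleR matrix_vector_right_distrib abs_triangle_ineq)
    then have "(\<Sum>i\<in>UNIV. \<bar>(D *v ?m) $ i\<bar>)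
        \<le> 1/2 * (\<Sum>i\<in>UNIV. \<bar>(D *v c) $ i\<bar>) + 1/2 * (\<Sum>i\<in>UNIV. \<bar>(D *v d) $ i\<bar>)"
      by (simp add: sum_distrib_left flip: sum.distrib) (intro sum_mono, simp)
    then have pen: "lam * (\<Sum>i\<in>UNIV. \<bar>(D *v ?m) $ i\<bar>)
        \<le> 1/2 * (lam * (\<Sum>i\<in>UNIV. \<bar>(D *v c) $ i\<bar>)) + 1/2 * (lam * (\<Sum>i\<in>UNIV. \<bar>(D *v d) $ i\<bar>))"
      using mult_left_mono[OF _ assms] by (fastforce simp: algebra_simps)
    have "(norm (y - ?m))\<^sup>2 = 1/2 * (norm (y - c))\<^sup>2 + 1/2 * (norm (y - d))\<^sup>2 - 1/4 * (norm (c - d))\<^sup>2"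
      by (simp add: power2_norm_eq_inner inner_diff_left inner_diff_right inner_add_left
          inner_add_right inner_commute field_simps)
    moreover have "0 < (norm (c - d))\<^sup>2" using \<open>c \<noteq> d\<close> by simp
    ultimately show False using le pen unfolding objective_def by linarith
  qed
  ultimately show ?thesis by blast
qed

end

theory Submission
  imports Defs
begin

text \<open>Write \<open>f\<close> for the estimator. The dual problem projects \<open>y\<close> onto the zonotope
  \<open>{D\<^sup>T v | infnorm v \<le> lam}\<close>, and \<open>f y\<close> is the residual \<open>y - D\<^sup>T u\<close> of that projection
  (\<open>signal_approx_eq_dual_residual\<close>). Projections onto convex sets are monotone, so \<open>f\<close> is
  1-Lipschitz (\<open>signal_approx_lipschitz\<close>).

  Let \<open>u\<close> be a dual solution at \<open>y\<close> with boundary set \<open>B\<close>. Complementary slackness makes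
  \<open>D (f y)\<close> vanish off \<open>B\<close>, so \<open>f y\<close> lies in \<open>N = null D\<^bsub>-B\<^esub>\<close>, while the coordinates of \<open>u\<close> off
  \<open>B\<close> contribute to \<open>D\<^sup>T u\<close> only a vector orthogonal to \<open>N\<close>. Hence \<open>f y = P\<^sub>N (y - D\<^sup>T w)\<close>, where
  \<open>w\<close> keeps the coordinates of \<open>u\<close> on \<open>B\<close>, each \<open>lam\<close> or \<open>- lam\<close>
  (\<open>signal_approx_eq_projection\<close>). There are only finitely many pairs of \<open>B\<close> and \<open>w\<close>, so \<open>f\<close> is a
  continuous selection from finitely many affine maps. Two distinct affine maps agree on a null set
  only; away from the union \<open>Z\<close> of these null sets, every affine map that matches \<open>f\<close> at \<open>y\<close>
  matches it near \<open>y\<close> (\<open>piecewise_affine_locally_affine\<close>). So at \<open>y \<notin> Z\<close> the map \<open>f\<close> has derivative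
  \<open>P\<^sub>N\<close>, whichever dual solution produced \<open>N\<close> (\<open>signal_approx_locally_projection\<close>). Uniqueness of
  derivatives gives at once that \<open>N\<close> does not depend on the dual solution, and the divergence of
  \<open>f\<close> at \<open>y\<close> is the trace of \<open>P\<^sub>N\<close>, that is \<open>dim N\<close>.

  It remains to know Stein's identity \<open>Cov (g Y) Y\<^sub>i = \<sigma>\<^sup>2 E (\<partial>\<^sub>i g Y)\<close> for a Lipschitz function that is
  differentiable almost everywhere (\<open>Stein_identity_lipschitz\<close>). By translation invariance of
  Lebesgue measure, the difference quotient of \<open>g\<close> integrated against the Gaussian weight equals
  \<open>g\<close> integrated against the opposite difference quotient of the weight, and dominated convergence
  passes to the limit on both sides.

  The selection \<open>uhat\<close> is arbitrary, so the nullity need not be a measurable function; it agrees almost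
  everywhere with the measurable divergence of \<open>f\<close>, which is why its expectation is taken in the
  completed measure.\<close>

section \<open>Orthogonal projections\<close>

definition orth_proj :: "'a::euclidean_space set \<Rightarrow> 'a \<Rightarrow> 'a" where
  "orth_proj S x = (THE p. p \<in> S \<and> (\<forall>z\<in>S. (x - p) \<bullet> z = 0))"

lemma orth_proj_eqI:
  assumes S: "subspace S" and p: "p \<in> S" "\<And>z. z \<in> S \<Longrightarrow> (x - p) \<bullet> z = 0"
  shows "orth_proj S x = p"
  unfolding orth_proj_def
proof (rule the_equality)
  fix q assume q: "q \<in> S \<and> (\<forall>z\<in>S. (x - q) \<bullet> z = 0)"
  have "q - p \<in> S" using S p q by (intro subspace_diff) auto
  then have "(x - p) \<bullet> (q - p) = 0" "(x - q) \<bullet> (q - p) = 0" using p q by auto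
  then have "(q - p) \<bullet> (q - p) = 0" by (simp add: inner_diff_left)
  then show "q = p" by simp
qed (use p in auto)

text \<open>The coordinate formula turns linearity and the trace into computations.\<close>
lemma orth_proj_orthonormal_basis:
  assumes "subspace S"
  obtains B where "finite B" "card B = dim S" "\<And>b. b \<in> B \<Longrightarrow> norm b = 1"
    "orth_proj S = (\<lambda>x. \<Sum>b\<in>B. (x \<bullet> b) *\<^sub>R b)"
proof -
  obtain B where B: "B \<subseteq> S" "pairwise orthogonal B" "\<And>x. x \<in> B \<Longrightarrow> norm x = 1"
    "independent B" "card B = dim S" "span B = S"
    using orthonormal_basis_subspace[OF assms] by blast
  have fin: "finite B" using B(4) by (rule independent_imp_finite)
  have "orth_proj S x = (\<Sum>b\<in>B. (x \<bullet> b) *\<^sub>R b)" (is "_ = ?p") for x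
  proof (rule orth_proj_eqI[OF assms])
    show "?p \<in> S" using assms B(1) by (intro subspace_sum subspace_scale) auto
    fix z assume "z \<in> S"
    then have "z \<in> span B" using B by simp
    moreover have "orthogonal (x - ?p) c" if c: "c \<in> B" for c
    proof -
      have "?p \<bullet> c = (\<Sum>b\<in>B. if b = c then x \<bullet> c else 0)"
        unfolding inner_sum_left
      proof (rule sum.cong)
        fix b assume "b \<in> B"
        then show "(x \<bullet> b) *\<^sub>R b \<bullet> c = (if b = c then x \<bullet> c else 0)"
          using B(2,3) c by (auto simp: pairwise_def orthogonal_def norm_eq_1)
      qed simp
      then show ?thesis using c fin by (simp add: orthogonal_def inner_diff_left)
    qed
    ultimately have "orthogonal (x - ?p) z" by (rule orthogonal_to_span)
    then show "(x - ?p) \<bullet> z = 0" by (simp add: orthogonal_def)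
  qed
  then show thesis using that[OF fin B(5) B(3)] by blast
qed

lemma linear_orth_proj: "subspace S \<Longrightarrow> linear (orth_proj S)"
  by (erule orth_proj_orthonormal_basis)
     (simp add: linear_iff inner_add_left scaleR_add_left sum.distrib scaleR_sum_right)

text \<open>The diagonal entry at \<open>e\<close> is the sum of \<open>(b \<bullet> e)\<^sup>2\<close> over an orthonormal basis of the subspace; summing
  over \<open>e\<close> first leaves the squared norms of the vectors \<open>b\<close>, each equal to 1.\<close>
lemma trace_orth_proj:
  assumes "subspace S"
  shows "(\<Sum>e\<in>Basis. orth_proj S e \<bullet> e) = real (dim S)"
proof -
  obtain B where B: "finite B" "card B = dim S" "\<And>b. b \<in> B \<Longrightarrow> norm b = 1"
    "orth_proj S = (\<lambda>x. \<Sum>b\<in>B. (x \<bullet> b) *\<^sub>R b)"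
    using orth_proj_orthonormal_basis[OF assms] by blast
  have "(\<Sum>e\<in>Basis. orth_proj S e \<bullet> e) = (\<Sum>b\<in>B. \<Sum>e\<in>Basis. (b \<bullet> e) * (b \<bullet> e))"
    unfolding B(4) inner_sum_left by (subst sum.swap) (simp add: inner_commute)
  also have "\<dots> = (\<Sum>b\<in>B. b \<bullet> b)" by (simp only: euclidean_inner[symmetric])
  also have "\<dots> = real (dim S)" using B by (simp add: norm_eq_1)
  finally show ?thesis .
qed

lemma trace_orth_proj_cart:
  fixes S :: "(real^'n) set"
  assumes "subspace S"
  shows "(\<Sum>i\<in>UNIV. orth_proj S (axis i 1) $ i) = real (dim S)"
proof -
  have Basis: "(Basis :: (real^'n) set) = range (\<lambda>i. axis i 1)" by (auto simp: Basis_vec_def)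
  have inj: "inj (\<lambda>i. axis i 1 :: real^'n)" by (simp add: inj_on_def axis_eq_axis)
  have "(\<Sum>e\<in>Basis. orth_proj S e \<bullet> e) = (\<Sum>e\<in>range (\<lambda>i. axis i 1). orth_proj S e \<bullet> e)"
    by (rule sum.cong[OF Basis refl])
  also have "\<dots> = (\<Sum>i\<in>UNIV. orth_proj S (axis i 1) \<bullet> axis i 1)"
    by (subst sum.reindex[OF inj]) (simp only: comp_def)
  finally show ?thesis using trace_orth_proj[OF assms] by (simp add: inner_axis)
qed

text \<open>A subspace can be read off from its projection; this is how equality of two
  derivatives of the estimator becomes equality of two null spaces.\<close>
lemma range_orth_proj:
  assumes "subspace S"
  shows "range (orth_proj S) = S"
proof
  have "orth_proj S x \<in> S" for x
  proof -
    obtain p z where "p \<in> span S" "\<And>w. w \<in> span S \<Longrightarrow> orthogonal z w" "x = p + z"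
      using orthogonal_subspace_decomp_exists[of S x] by metis
    then show ?thesis
      using orth_proj_eqI[OF assms, of p x] assms
      by (auto simp: span_eq_iff[THEN iffD2] orthogonal_def)
  qed
  then show "range (orth_proj S) \<subseteq> S" by blast
  show "S \<subseteq> range (orth_proj S)"
    using orth_proj_eqI[OF assms] by (metis diff_self inner_zero_left rangeI subsetI)
qed

section \<open>Continuous selections of finitely many affine maps\<close>

text \<open>Pairing the difference of the two maps with its value at a point where they differ gives a scalar
  affine function that is not identically zero, so its zero set is a hyperplane or empty.\<close>
lemma negligible_affine_maps_agree:
  fixes L L' :: "'a::euclidean_space \<Rightarrow> 'b::euclidean_space"
  assumes "linear L" "linear L'" and ne: "\<exists>y. L y + c \<noteq> L' y + c'"
  shows "negligible {y. L y + c = L' y + c'}"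
proof -
  obtain y0 where y0: "L y0 + c \<noteq> L' y0 + c'" using ne by blast
  define e where "e = L y0 + c - (L' y0 + c')"
  define a where "a = adjoint L e - adjoint L' e"
  define b where "b = (c' - c) \<bullet> e"
  have diff: "(L y + c - (L' y + c')) \<bullet> e = a \<bullet> y - b" for y
    using adjoint_works[OF assms(1), of y e] adjoint_works[OF assms(2), of y e]
    by (simp add: a_def b_def inner_diff_left inner_diff_right inner_add_right inner_commute)
  have "a \<noteq> 0 \<or> b \<noteq> 0"
    using diff[of y0] y0 by (auto simp: e_def)
  then have "negligible {y. a \<bullet> y = b}" by (rule negligible_hyperplane)
  moreover have "{y. L y + c = L' y + c'} \<subseteq> {y. a \<bullet> y = b}"
  proof
    fix y assume "y \<in> {y. L y + c = L' y + c'}"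
    then show "y \<in> {y. a \<bullet> y = b}" using diff[of y] by simp
  qed
  ultimately show ?thesis by (rule negligible_subset)
qed

text \<open>The exceptional set is where two distinct affine pieces agree. Off it, all pieces matching \<open>f\<close> at
  \<open>y\<close> are one and the same function. A piece not matching at \<open>y\<close> does not match anywhere near \<open>y\<close>
  either, because by continuity the set where a piece matches is closed; so only that one function is
  left near \<open>y\<close>.\<close>
lemma piecewise_affine_locally_affine:
  fixes f :: "'a::euclidean_space \<Rightarrow> 'b::euclidean_space"
  assumes cont: "continuous_on UNIV f" and fin: "finite \<A>"
    and lin: "\<And>L c. (L, c) \<in> \<A> \<Longrightarrow> linear L"
    and pieces: "\<And>y. \<exists>(L, c)\<in>\<A>. f y = L y + c"
  obtains Z where "closed Z" "negligible Z"
    "\<And>y L c. y \<notin> Z \<Longrightarrow> (L, c) \<in> \<A> \<Longrightarrow> f y = L y + c \<Longrightarrow> \<forall>\<^sub>F z in nhds y. f z = L z + c"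
proof
  define Q where "Q = {((L, c), (L', c')). (L, c) \<in> \<A> \<and> (L', c') \<in> \<A> \<and> (\<exists>y. L y + c \<noteq> L' y + c')}"
  define Z where "Z = (\<Union>((L, c), (L', c'))\<in>Q. {y. L y + c = L' y + c'})"
  have contL: "continuous_on UNIV (\<lambda>y. L y + c)" if "(L, c) \<in> \<A>" for L c
    using lin[OF that] by (intro continuous_intros linear_continuous_on linear_conv_bounded_linear[THEN iffD1])
  have "Q \<subseteq> \<A> \<times> \<A>" by (auto simp: Q_def)
  then have finQ: "finite Q" using fin by (meson finite_SigmaI finite_subset)
  show "closed Z"
    unfolding Z_def using finQ by (intro closed_UN) (auto simp: Q_def intro: closed_Collect_eq contL)
  show "negligible Z"
    unfolding Z_def
  proof (rule negligible_Union, use finQ in simp, safe)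
    fix L c L' c' assume "((L, c), (L', c')) \<in> Q"
    then show "negligible {y. L y + c = L' y + c'}"
      using lin by (intro negligible_affine_maps_agree) (auto simp: Q_def)
  qed
  fix y L c
  assume y: "y \<notin> Z" and LA: "(L, c) \<in> \<A>" and fy: "f y = L y + c"
  define \<C> where "\<C> = {(L', c') \<in> \<A>. f y \<noteq> L' y + c'}"
  define V where "V = (\<Union>(L', c')\<in>\<C>. {z. f z = L' z + c'})"
  have "closed V"
    unfolding V_def using fin
    by (intro closed_UN) (auto simp: \<C>_def intro: finite_subset closed_Collect_eq cont contL)
  moreover have "y \<notin> V" by (auto simp: V_def \<C>_def)
  ultimately have "\<forall>\<^sub>F z in nhds y. z \<in> - V"
    by (intro eventually_nhds_in_open) auto
  then show "\<forall>\<^sub>F z in nhds y. f z = L z + c"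
  proof (rule eventually_mono)
    fix z assume z: "z \<in> - V"
    obtain L' c' where L': "(L', c') \<in> \<A>" "f z = L' z + c'" using pieces[of z] by auto
    then have "f y = L' y + c'" using z by (auto simp: V_def \<C>_def)
    then have agree: "L' y + c' = L y + c" using fy by simp
    have "\<forall>x. L' x + c' = L x + c"
    proof (rule ccontr)
      assume "\<not> ?thesis"
      then have "\<exists>x. L' x + c' \<noteq> L x + c" by (rule not_all[THEN iffD1])
      then have "((L', c'), (L, c)) \<in> Q" using LA L'(1) by (auto simp only: Q_def mem_Collect_eq prod.case)
      then have "y \<in> Z"
        unfolding Z_def by (rule UN_I) (simp only: prod.case mem_Collect_eq agree)
      then show False using y by contradiction
    qed
    then show "f z = L z + c" using L' by simp
  qed
qed

section \<open>The dual problem\<close>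

lemma inner_transpose_mult:
  fixes D :: "real^'n^'m"
  shows "(transpose D *v u) \<bullet> x = u \<bullet> (D *v x)"
  by (simp add: dot_lmul_matrix)

lemma infnorm_le_iff_cart:
  fixes v :: "real^'m"
  shows "infnorm v \<le> r \<longleftrightarrow> (\<forall>i. \<bar>v $ i\<bar> \<le> r)"
proof
  show "infnorm v \<le> r \<Longrightarrow> \<forall>i. \<bar>v $ i\<bar> \<le> r"
    using component_le_infnorm_cart order_trans by blast
  show "\<forall>i. \<bar>v $ i\<bar> \<le> r \<Longrightarrow> infnorm v \<le> r"
    unfolding infnorm_cart by (rule cSup_least) auto
qed

text \<open>\<open>D\<^sup>T u\<close> is the point of the compact convex set \<open>{D\<^sup>T v | infnorm v \<le> lam}\<close> closest to \<open>y\<close>, and the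
  residual makes an obtuse angle with every direction into that set.\<close>
lemma dual_variational_inequality:
  fixes D :: "real^'n^'m"
  assumes u: "dual_solution D lam y u" and v: "infnorm v \<le> lam"
  shows "(y - transpose D *v u) \<bullet> (transpose D *v v - transpose D *v u) \<le> 0"
proof -
  let ?C = "{w :: real^'m. infnorm w \<le> lam}"
  let ?S = "(*v) (transpose D) ` ?C"
  have box: "?C = cbox (\<chi> i. - lam) (\<chi> i. lam)"
    by (auto simp: infnorm_le_iff_cart mem_box_cart abs_le_iff) (meson minus_le_iff)+
  have "convex ?S"
    unfolding box by (intro convex_linear_image matrix_vector_mul_linear convex_box)
  moreover have "closed ?S"
    unfolding box
    by (intro compact_imp_closed compact_continuous_image compact_cbox linear_continuous_on
        linear_conv_bounded_linear[THEN iffD1] matrix_vector_mul_linear)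
  moreover have uS: "infnorm u \<le> lam"
    and min: "\<And>w. infnorm w \<le> lam \<Longrightarrow> norm (y - transpose D *v u) \<le> norm (y - transpose D *v w)"
    using u by (auto simp: dual_solution_def is_arg_min_def not_less)
  ultimately show ?thesis
    using v by (intro any_closest_point_dot[of ?S]) (auto simp: dist_norm)
qed

lemma dual_solution_component_bound:
  fixes D :: "real^'n^'m"
  assumes "dual_solution D lam y u"
  shows "\<bar>u $ j\<bar> \<le> lam"
proof -
  have "infnorm u \<le> lam"
    using assms unfolding dual_solution_def is_arg_min_def by blast
  then show ?thesis unfolding infnorm_le_iff_cart by blast
qed

lemma mult_le_abs_bound:
  fixes u x r :: real
  assumes "\<bar>u\<bar> \<le> r"
  shows "u * x \<le> r * \<bar>x\<bar>"
  using abs_ge_self[of "u * x"] mult_right_mono[OF assms abs_ge_zero[of x]]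
  unfolding abs_mult by (rule order_trans)

text \<open>Moving only the coordinate \<open>u\<^sub>i\<close> to \<open>lam\<close> times the sign of \<open>(D b)\<^sub>i\<close> stays within the box, so the
  variational inequality forces \<open>u\<^sub>i\<close> to be as well aligned with \<open>(D b)\<^sub>i\<close> as the box allows.\<close>
lemma dual_complementary_slackness:
  fixes D :: "real^'n^'m" and u :: "real^'m"
  assumes u: "dual_solution D lam y u"
  defines "b \<equiv> y - transpose D *v u"
  shows "u $ i * (D *v b) $ i = lam * \<bar>(D *v b) $ i\<bar>"
proof -
  have box: "\<bar>u $ j\<bar> \<le> lam" for j
    by (rule dual_solution_component_bound[OF u])
  then have lam: "0 \<le> lam" using abs_ge_zero order_trans by blast
  let ?x = "(D *v b) $ i"
  define v where "v = (\<chi> j. if j = i then lam * sgn ?x else u $ j)"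
  have "infnorm v \<le> lam"
    using box lam by (auto simp: infnorm_le_iff_cart v_def abs_mult abs_sgn_eq)
  from dual_variational_inequality[OF u this]
  have "b \<bullet> (transpose D *v (v - u)) \<le> 0"
    by (simp only: b_def matrix_vector_mult_diff_distrib)
  then have "(D *v b) \<bullet> (v - u) \<le> 0"
    using inner_transpose_mult[of D "v - u" b] inner_commute[of b "transpose D *v (v - u)"]
      inner_commute[of "D *v b" "v - u"] by linarith
  also have "(D *v b) \<bullet> (v - u) = (\<Sum>j\<in>UNIV. if j = i then ?x * (lam * sgn ?x - u $ i) else 0)"
    unfolding inner_vec_def by (rule sum.cong) (auto simp: v_def)
  finally have "?x * (lam * sgn ?x - u $ i) \<le> 0" by simp
  then have "lam * \<bar>?x\<bar> \<le> u $ i * ?x" by (simp add: algebra_simps abs_sgn)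
  moreover have "u $ i * ?x \<le> lam * \<bar>?x\<bar>"
    by (rule mult_le_abs_bound[OF box])
  ultimately show ?thesis by simp
qed

text \<open>Complementary slackness says that \<open>D\<^sup>T u\<close> is a subgradient of the penalty at the residual \<open>b\<close>, which
  is the optimality condition of the primal problem: the objective at any \<open>c\<close> exceeds the one at
  \<open>b\<close> by at least \<open>(norm (b - c))\<^sup>2 / 2\<close>.\<close>
lemma signal_approx_eq_dual_residual:
  fixes D :: "real^'n^'m" and u :: "real^'m"
  assumes u: "dual_solution D lam y u"
  shows "signal_approx D lam y = y - transpose D *v u"
proof -
  define b where "b = y - transpose D *v u"
  have box: "\<bar>u $ j\<bar> \<le> lam" for j
    by (rule dual_solution_component_bound[OF u])
  then have lam: "0 \<le> lam" using abs_ge_zero order_trans by blast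
  have "objective D lam y b \<le> objective D lam y c" for c
  proof -
    have "u \<bullet> (D *v b) = lam * (\<Sum>i\<in>UNIV. \<bar>(D *v b) $ i\<bar>)"
      using dual_complementary_slackness[OF u] by (simp add: inner_vec_def sum_distrib_left b_def)
    moreover have "u \<bullet> (D *v c) \<le> lam * (\<Sum>i\<in>UNIV. \<bar>(D *v c) $ i\<bar>)"
      unfolding inner_vec_def sum_distrib_left
    proof (rule sum_mono)
      fix i
      show "u $ i \<bullet> (D *v c) $ i \<le> lam * \<bar>(D *v c) $ i\<bar>"
        unfolding inner_real_def by (rule mult_le_abs_bound[OF box])
    qed
    moreover have "u \<bullet> (D *v b) - u \<bullet> (D *v c) = (y - b) \<bullet> (b - c)"
    proof -
      have "y - b = transpose D *v u" by (simp add: b_def)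
      then show ?thesis
        by (simp only: inner_transpose_mult matrix_vector_mult_diff_distrib inner_diff_right)
    qed
    moreover have "(norm (y - c))\<^sup>2 = (norm (y - b))\<^sup>2 + 2 * ((y - b) \<bullet> (b - c)) + (norm (b - c))\<^sup>2"
      unfolding power2_norm_eq_inner
      by (simp add: inner_diff_left inner_diff_right inner_commute algebra_simps)
    ultimately show ?thesis
      unfolding objective_def using zero_le_power2[of "norm (b - c)"] by linarith
  qed
  then have "is_arg_min (objective D lam y) (\<lambda>_. True) b"
    by (simp add: is_arg_min_def not_less)
  then show ?thesis
    unfolding signal_approx_def b_def[symmetric]
    using signal_approx_ex1[OF lam, of D y] by (intro the1_equality)
qed

text \<open>Adding the variational inequalities at two points shows that the residual of a convex projection is
  firmly nonexpansive; the Cauchy-Schwarz inequality then gives the Lipschitz bound.\<close>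
lemma signal_approx_lipschitz:
  fixes D :: "real^'n^'m"
  assumes lam: "0 \<le> lam"
  shows "1-lipschitz_on UNIV (signal_approx D lam)"
proof (rule lipschitz_onI)
  fix y z :: "real^'n"
  obtain u where u: "dual_solution D lam y u" using dual_solution_exists[OF lam] by blast
  obtain v where v: "dual_solution D lam z v" using dual_solution_exists[OF lam] by blast
  let ?p = "transpose D *v u" and ?q = "transpose D *v v"
  have box: "infnorm u \<le> lam" "infnorm v \<le> lam"
    using u v by (auto simp: dual_solution_def is_arg_min_def)
  have "(y - ?p) \<bullet> (?q - ?p) \<le> 0"
    by (rule dual_variational_inequality[OF u box(2)])
  moreover have "(z - ?q) \<bullet> (?p - ?q) \<le> 0"
    by (rule dual_variational_inequality[OF v box(1)])
  moreover define a b where "a = y - ?p" and "b = z - ?q"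
  ultimately have "a \<bullet> (?q - ?p) + b \<bullet> (?p - ?q) \<le> 0" by simp
  moreover have "a \<bullet> (?q - ?p) + b \<bullet> (?p - ?q) = (a - b) \<bullet> (a - b) - (y - z) \<bullet> (a - b)"
  proof -
    have "?q - ?p = (a - b) - (y - z)" "?p - ?q = - ((a - b) - (y - z))"
      by (simp_all add: a_def b_def)
    then show ?thesis
      by (simp only: inner_diff_left inner_diff_right inner_minus_right inner_commute[of y] inner_commute[of z])
  qed
  ultimately have "(a - b) \<bullet> (a - b) \<le> (y - z) \<bullet> (a - b)" by linarith
  also have "\<dots> \<le> norm (y - z) * norm (a - b)" by (rule norm_cauchy_schwarz)
  finally have "norm (a - b) * norm (a - b) \<le> norm (y - z) * norm (a - b)"
    by (simp add: dot_square_norm power2_eq_square)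
  then have "norm (a - b) \<le> norm (y - z)"
    by (cases "norm (a - b) = 0") auto
  then show "dist (signal_approx D lam y) (signal_approx D lam z) \<le> 1 * dist y z"
    by (simp add: signal_approx_eq_dual_residual[OF u] signal_approx_eq_dual_residual[OF v] dist_norm a_def b_def)
qed simp

lemma subspace_null_space_minus: "subspace (null_space_minus D B)"
  by (auto simp: subspace_def null_space_minus_def inner_add_right)

definition restrict_vec :: "'m set \<Rightarrow> real^'m \<Rightarrow> real^'m" where
  "restrict_vec B u = (\<chi> i. if i \<in> B then u $ i else 0)"

text \<open>The residual \<open>b\<close> lies in the null space \<open>N\<close> of \<open>D\<^bsub>-B\<^esub>\<close>: off the boundary \<open>\<bar>u\<^sub>i\<bar> < lam\<close>, which
  complementary slackness allows only if \<open>(D b)\<^sub>i = 0\<close>. The part of \<open>D\<^sup>T u\<close> coming from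
  coordinates off \<open>B\<close> is a combination of rows of \<open>D\<^bsub>-B\<^esub>\<close> and so is orthogonal to \<open>N\<close>. In this
  form the affine map is determined by \<open>B\<close> and the restricted vector, and these range over a finite
  set.\<close>
lemma signal_approx_eq_projection:
  fixes D :: "real^'n^'m" and u :: "real^'m"
  assumes u: "dual_solution D lam y u"
  defines "B \<equiv> boundary_set lam u"
  shows "signal_approx D lam y
    = orth_proj (null_space_minus D B) y
      + - orth_proj (null_space_minus D B) (transpose D *v restrict_vec B u)"
proof -
  let ?N = "null_space_minus D B"
  define b where "b = y - transpose D *v u"
  have Db: "(D *v b) $ i = row i D \<bullet> b" for i and b :: "real^'n"
    by (simp add: matrix_vector_mult_def row_def inner_vec_def)
  have box: "\<bar>u $ j\<bar> \<le> lam" for j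
    by (rule dual_solution_component_bound[OF u])
  have "orth_proj ?N (y - transpose D *v restrict_vec B u) = b"
  proof (rule orth_proj_eqI[OF subspace_null_space_minus])
    have "(D *v b) $ i = 0" if "i \<notin> B" for i
    proof (rule ccontr)
      assume nz: "(D *v b) $ i \<noteq> 0"
      have "\<bar>u $ i\<bar> * \<bar>(D *v b) $ i\<bar> = \<bar>lam\<bar> * \<bar>(D *v b) $ i\<bar>"
        using arg_cong[OF dual_complementary_slackness[OF u, of i], of abs]
        by (simp add: abs_mult b_def del: transpose_matrix_vector)
      then have "\<bar>u $ i\<bar> = lam" using nz box[of i] by simp
      then show False using that by (simp add: B_def boundary_set_def)
    qed
    then show "b \<in> ?N" by (simp add: null_space_minus_def Db)
    fix z assume "z \<in> ?N"
    then have z: "\<And>i. i \<notin> B \<Longrightarrow> (D *v z) $ i = 0" by (simp add: null_space_minus_def Db)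
    have "y - transpose D *v restrict_vec B u - b = transpose D *v (u - restrict_vec B u)"
      by (simp add: b_def matrix_vector_mult_diff_distrib del: transpose_matrix_vector)
    then have "(y - transpose D *v restrict_vec B u - b) \<bullet> z = (u - restrict_vec B u) \<bullet> (D *v z)"
      by (simp only: inner_transpose_mult)
    also have "\<dots> = 0"
      unfolding inner_vec_def using z by (intro sum.neutral) (auto simp: restrict_vec_def)
    finally show "(y - transpose D *v restrict_vec B u - b) \<bullet> z = 0" .
  qed
  then show ?thesis
    unfolding signal_approx_eq_dual_residual[OF u] b_def[symmetric]
    by (simp add: linear_diff[OF linear_orth_proj[OF subspace_null_space_minus]])
qed

lemma finite_sign_vectors: "finite {w :: real^'m. \<forall>i. w $ i \<in> {- lam, 0, lam}}"
proof -
  have "finite (PiE (UNIV :: 'm set) (\<lambda>_. {- lam, 0, lam}))" by (intro finite_PiE) auto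
  then have "finite (vec_lambda ` PiE (UNIV :: 'm set) (\<lambda>_. {- lam, 0, lam}))" by simp
  moreover have "{w :: real^'m. \<forall>i. w $ i \<in> {- lam, 0, lam}} \<subseteq> vec_lambda ` PiE UNIV (\<lambda>_. {- lam, 0, lam})"
  proof
    fix w :: "real^'m" assume "w \<in> {w. \<forall>i. w $ i \<in> {- lam, 0, lam}}"
    then have "vec_nth w \<in> PiE UNIV (\<lambda>_. {- lam, 0, lam})" by (auto simp: PiE_def Pi_def)
    then show "w \<in> vec_lambda ` PiE UNIV (\<lambda>_. {- lam, 0, lam})"
      by (metis image_eqI vec_nth_inverse)
  qed
  ultimately show ?thesis by (rule rev_finite_subset)
qed

text \<open>At a given \<open>y\<close> every dual solution supplies a matching affine piece, and off \<open>Z\<close> each of them is a local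
  description of the estimator; hence the derivative is the projection for each choice of
  \<open>u\<close>.\<close>
lemma signal_approx_locally_projection:
  fixes D :: "real^'n^'m"
  assumes lam: "0 \<le> lam"
  obtains Z where "closed Z" "negligible Z"
    "\<And>y u. y \<notin> Z \<Longrightarrow> dual_solution D lam y u \<Longrightarrow>
       (signal_approx D lam has_derivative orth_proj (null_space_minus D (boundary_set lam u))) (at y)"
proof -
  let ?P = "\<lambda>B. orth_proj (null_space_minus D B)"
  let ?W = "{w :: real^'m. \<forall>i. w $ i \<in> {- lam, 0, lam}}"
  define \<A> where "\<A> = (\<lambda>(B, w). (?P B, - ?P B (transpose D *v w))) ` (UNIV \<times> ?W)"
  have cont: "continuous_on UNIV (signal_approx D lam)"
    by (rule lipschitz_on_continuous_on[OF signal_approx_lipschitz[OF lam]])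
  have fin: "finite \<A>" unfolding \<A>_def by (intro finite_imageI finite_cartesian_product finite_sign_vectors) simp
  have lin: "linear L" if "(L, c) \<in> \<A>" for L c
    using that linear_orth_proj[OF subspace_null_space_minus] by (auto simp: \<A>_def)
  have mem: "(?P (boundary_set lam u), - ?P (boundary_set lam u) (transpose D *v restrict_vec (boundary_set lam u) u)) \<in> \<A>" for u
  proof -
    have "restrict_vec (boundary_set lam u) u \<in> ?W"
      by (auto simp: restrict_vec_def boundary_set_def abs_if split: if_splits)
    then show ?thesis
      unfolding \<A>_def by (intro image_eqI[where x = "(boundary_set lam u, restrict_vec (boundary_set lam u) u)"]) auto
  qed
  have pieces: "\<exists>(L, c)\<in>\<A>. signal_approx D lam y = L y + c" for y
  proof -
    obtain u where u: "dual_solution D lam y u" using dual_solution_exists[OF lam] by blast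
    show ?thesis
      by (rule bexI[OF _ mem[of u]]) (simp only: prod.case signal_approx_eq_projection[OF u])
  qed
  obtain Z where Z: "closed Z" "negligible Z"
    "\<And>y L c. y \<notin> Z \<Longrightarrow> (L, c) \<in> \<A> \<Longrightarrow> signal_approx D lam y = L y + c \<Longrightarrow>
       \<forall>\<^sub>F z in nhds y. signal_approx D lam z = L z + c"
    by (rule piecewise_affine_locally_affine[OF cont fin lin pieces]) (assumption, rule that)
  have "(signal_approx D lam has_derivative ?P (boundary_set lam u)) (at y)"
    if y: "y \<notin> Z" and u: "dual_solution D lam y u" for y u
  proof -
    let ?L = "?P (boundary_set lam u)" and ?c = "- ?P (boundary_set lam u) (transpose D *v restrict_vec (boundary_set lam u) u)"
    have "\<forall>\<^sub>F z in nhds y. signal_approx D lam z = ?L z + ?c"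
      by (rule Z(3)[OF y mem signal_approx_eq_projection[OF u]])
    then have eq: "\<forall>\<^sub>F z in nhds y. ?L z + ?c = signal_approx D lam z"
      by (rule eventually_mono) (rule sym)
    have "((\<lambda>z. ?L z + ?c) has_derivative ?L) (at y)"
      by (intro has_derivative_add_const linear_imp_has_derivative linear_orth_proj subspace_null_space_minus)
    then show ?thesis
    proof (rule has_derivative_transform_eventually)
      show "\<forall>\<^sub>F z in at y. ?L z + ?c = signal_approx D lam z"
        using eq unfolding eventually_nhds_conv_at by (rule conjunct1)
      show "?L y + ?c = signal_approx D lam y" by (rule eventually_nhds_x_imp_x[OF eq])
    qed simp
  qed
  then show thesis by (rule that[OF Z(1,2)])
qed

section \<open>Gaussian weights\<close>

text \<open>The density of the normal law without its normalising constant, on an arbitrary Euclidean space;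
  both sides of Stein's identity scale alike.\<close>
definition gauss_weight :: "'a::euclidean_space \<Rightarrow> real \<Rightarrow> 'a \<Rightarrow> real" where
  "gauss_weight \<mu> \<sigma> y = exp (- ((norm (y - \<mu>))\<^sup>2 / (2 * \<sigma>\<^sup>2)))"

lemma borel_measurable_gauss_weight [measurable]: "gauss_weight \<mu> \<sigma> \<in> borel_measurable borel"
  unfolding gauss_weight_def by measurable

text \<open>The function factorises over the coordinates into one-dimensional normal densities, up to
  constants.\<close>
lemma integrable_exp_neg_norm_sq:
  fixes \<mu> :: "'a::euclidean_space"
  assumes "0 < c"
  shows "integrable lborel (\<lambda>y. exp (- (c * (norm (y - \<mu>))\<^sup>2)))"
proof -
  let ?f = "\<lambda>b x. exp (- (c * (x - \<mu> \<bullet> b)\<^sup>2)) :: real"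
  have prod: "exp (- (c * (norm (y - \<mu>))\<^sup>2)) = (\<Prod>b\<in>Basis. ?f b (y \<bullet> b))" for y
  proof -
    have "- (c * (norm (y - \<mu>))\<^sup>2) = (\<Sum>b\<in>Basis. - (c * (y \<bullet> b - \<mu> \<bullet> b)\<^sup>2))"
      unfolding power2_norm_eq_inner euclidean_inner[of "y - \<mu>" "y - \<mu>"]
      by (simp only: inner_diff_left power2_eq_square sum_distrib_left sum_negf)
    then show ?thesis by (simp only: exp_sum finite_Basis)
  qed
  \<comment> \<open>The standard deviation for which \<open>1 / (2 * s\<^sup>2) = c\<close>.\<close>
  define s where "s = 1 / sqrt (2 * c)"
  have s: "s\<^sup>2 = 1 / (2 * c)" "0 < s"
    using assms by (auto simp: s_def power_divide)
  have fin: "(\<integral>\<^sup>+x. ?f b x \<partial>lborel) \<noteq> top" for b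
  proof -
    have "integrable lborel (normal_density (\<mu> \<bullet> b) s)"
      using s by simp
    then have "integrable lborel (\<lambda>x. sqrt (2 * pi * s\<^sup>2) * normal_density (\<mu> \<bullet> b) s x)"
      by simp
    moreover have "sqrt (2 * pi * s\<^sup>2) * normal_density (\<mu> \<bullet> b) s x = ?f b x" for x
      using s assms by (simp add: normal_density_def)
    ultimately have "integrable lborel (?f b)" by simp
    then show ?thesis by (simp add: integrable_iff_bounded less_top)
  qed
  have "(\<integral>\<^sup>+y. ennreal (\<Prod>b\<in>Basis. ?f b (y \<bullet> b)) \<partial>lborel) = (\<Prod>b\<in>Basis. (\<integral>\<^sup>+x. ?f b x \<partial>lborel))"
    using nn_integral_lborel_prod[of "\<lambda>b x. ennreal (?f b x)"] by (simp add: prod_ennreal)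
  also have "\<dots> < \<infinity>"
    using fin by (simp add: ennreal_prod_eq_top flip: less_top)
  finally show ?thesis
    unfolding prod by (subst integrable_iff_bounded) (simp add: abs_prod)
qed

text \<open>Half of the Gaussian exponent absorbs the polynomial factor.\<close>
lemma integrable_of_Gaussian_tail:
  fixes h :: "'a::euclidean_space \<Rightarrow> real"
  assumes [measurable]: "h \<in> borel_measurable borel" and c: "0 < c"
    and bound: "\<And>y. \<bar>h y\<bar> \<le> K * (1 + norm (y - \<mu>))\<^sup>2 * exp (- (c * (norm (y - \<mu>))\<^sup>2))"
  shows "integrable lborel h"
proof (rule Bochner_Integration.integrable_bound)
  show "integrable lborel (\<lambda>y. \<bar>K\<bar> * (2 + 4 / c) * exp (- (c / 2 * (norm (y - \<mu>))\<^sup>2)))"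
    using c by (intro integrable_mult_right integrable_exp_neg_norm_sq) auto
  show "AE y in lborel. norm (h y) \<le> norm (\<bar>K\<bar> * (2 + 4 / c) * exp (- (c / 2 * (norm (y - \<mu>))\<^sup>2)))"
  proof (intro AE_I2)
    fix y
    let ?r = "norm (y - \<mu>)"
    have "(1 + ?r)\<^sup>2 \<le> 2 + 2 * ?r\<^sup>2"
      using zero_le_power2[of "1 - ?r"] by (simp add: power2_eq_square algebra_simps)
    also have "\<dots> \<le> (2 + 4 / c) * (1 + c / 2 * ?r\<^sup>2)"
      using c by (simp add: field_simps)
    also have "\<dots> \<le> (2 + 4 / c) * exp (c / 2 * ?r\<^sup>2)"
      using c by (intro mult_left_mono exp_ge_add_one_self) auto
    finally have poly: "(1 + ?r)\<^sup>2 \<le> (2 + 4 / c) * exp (c / 2 * ?r\<^sup>2)" .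
    have "\<bar>h y\<bar> \<le> \<bar>K\<bar> * (1 + ?r)\<^sup>2 * exp (- (c * ?r\<^sup>2))"
      using bound[of y] by (rule order_trans) (intro mult_right_mono, auto)
    also have "\<dots> \<le> \<bar>K\<bar> * ((2 + 4 / c) * exp (c / 2 * ?r\<^sup>2)) * exp (- (c * ?r\<^sup>2))"
      by (intro mult_right_mono mult_left_mono poly) auto
    also have "\<dots> = \<bar>K\<bar> * (2 + 4 / c) * exp (c / 2 * ?r\<^sup>2 + - (c * ?r\<^sup>2))"
      by (simp only: exp_add mult.assoc)
    also have "c / 2 * ?r\<^sup>2 + - (c * ?r\<^sup>2) = - (c / 2 * ?r\<^sup>2)"
      by (simp add: field_simps)
    finally show "norm (h y) \<le> norm (\<bar>K\<bar> * (2 + 4 / c) * exp (- (c / 2 * ?r\<^sup>2)))"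
      using c by (simp add: abs_mult)
  qed
qed simp

lemma abs_exp_diff_le:
  fixes a b m :: real
  assumes "a \<le> m" "b \<le> m"
  shows "\<bar>exp a - exp b\<bar> \<le> \<bar>a - b\<bar> * exp m"
proof -
  have *: "exp a - exp b \<le> (a - b) * exp m" if "b \<le> a" "a \<le> m" for a b :: real
  proof -
    have "exp a - exp b = exp a * (1 - exp (b - a))" by (simp add: exp_diff field_simps)
    also have "\<dots> \<le> exp a * (a - b)"
      using exp_ge_add_one_self[of "b - a"] by (intro mult_left_mono) (simp_all del: exp_ge_add_one_self)
    also have "\<dots> \<le> exp m * (a - b)" using that by (intro mult_right_mono) auto
    finally show ?thesis by (simp add: mult.commute)
  qed
  show ?thesis
    using *[of b a] *[of a b] assms by (cases "b \<le> a") (auto simp: abs_if)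
qed

text \<open>Domination for the difference quotients of the weight, uniformly in the step. The exponent changes
  by \<open>O(\<bar>t\<bar> (1 + r))\<close> with \<open>r = norm (y - \<mu>)\<close>, and along a step of length at most 1 the
  squared distance to \<open>\<mu>\<close> stays above \<open>r\<^sup>2 / 2 - 1\<close>, which costs half of the Gaussian decay.\<close>
lemma gauss_weight_shift_bound:
  fixes y \<mu> e :: "'a::euclidean_space"
  assumes e: "norm e = 1" and s: "0 < \<sigma>" and t: "\<bar>t\<bar> \<le> 1"
  shows "\<bar>gauss_weight \<mu> \<sigma> (y - t *\<^sub>R e) - gauss_weight \<mu> \<sigma> y\<bar>
     \<le> \<bar>t\<bar> * (exp (1 / (2 * \<sigma>\<^sup>2)) / \<sigma>\<^sup>2 * (1 + norm (y - \<mu>)) * exp (- (1 / (4 * \<sigma>\<^sup>2) * (norm (y - \<mu>))\<^sup>2)))"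
proof -
  let ?r = "norm (y - \<mu>)"
  define q where "q = (norm (y - t *\<^sub>R e - \<mu>))\<^sup>2"
  have ee: "e \<bullet> e = 1" using e by (simp add: norm_eq_1)
  have q: "q = ?r\<^sup>2 - 2 * t * ((y - \<mu>) \<bullet> e) + t\<^sup>2"
    unfolding q_def power2_norm_eq_inner
    by (simp add: inner_diff_left inner_diff_right inner_commute ee power2_eq_square algebra_simps)
  have ip: "\<bar>(y - \<mu>) \<bullet> e\<bar> \<le> ?r" using Cauchy_Schwarz_ineq2[of "y - \<mu>" e] e by simp
  have t2: "t\<^sup>2 \<le> \<bar>t\<bar>"
    using mult_left_mono[OF t abs_ge_zero[of t]] by (simp add: power2_eq_square)
  have tip: "\<bar>t * ((y - \<mu>) \<bullet> e)\<bar> \<le> \<bar>t\<bar> * ?r"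
    unfolding abs_mult by (intro mult_left_mono ip) auto
  have dq: "\<bar>q - ?r\<^sup>2\<bar> \<le> 2 * (\<bar>t\<bar> * (1 + ?r))"
  proof -
    have "q - ?r\<^sup>2 = t\<^sup>2 - 2 * (t * ((y - \<mu>) \<bullet> e))" by (simp add: q)
    moreover have "\<bar>t\<bar> * (1 + ?r) = \<bar>t\<bar> + \<bar>t\<bar> * ?r" by (simp add: distrib_left)
    ultimately show ?thesis using tip t2 zero_le_power2[of t] by linarith
  qed
  have "?r \<le> norm (y - t *\<^sub>R e - \<mu>) + \<bar>t\<bar>"
    using norm_triangle_ineq[of "y - t *\<^sub>R e - \<mu>" "t *\<^sub>R e"] e by (simp add: algebra_simps)
  then have "?r \<le> norm (y - t *\<^sub>R e - \<mu>) + 1" using t by simp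
  then have "?r\<^sup>2 \<le> (norm (y - t *\<^sub>R e - \<mu>) + 1)\<^sup>2" by (intro power_mono) auto
  also have "\<dots> \<le> 2 * q + 2"
    using zero_le_power2[of "norm (y - t *\<^sub>R e - \<mu>) - 1"] unfolding q_def
    by (simp add: power2_eq_square algebra_simps)
  finally have qlow: "?r\<^sup>2 / 2 - 1 \<le> q" by simp
  let ?m = "1 / (2 * \<sigma>\<^sup>2) + - (1 / (4 * \<sigma>\<^sup>2) * ?r\<^sup>2)"
  have m: "?m = - ((?r\<^sup>2 / 2 - 1) / (2 * \<sigma>\<^sup>2))" using s by (simp add: field_simps)
  have "- (q / (2 * \<sigma>\<^sup>2)) \<le> ?m"
    unfolding m using qlow s by (simp add: divide_right_mono)
  moreover have "- (?r\<^sup>2 / (2 * \<sigma>\<^sup>2)) \<le> ?m"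
  proof -
    have "?r\<^sup>2 / 2 - 1 \<le> ?r\<^sup>2" using zero_le_power2[of ?r] by linarith
    then show ?thesis unfolding m using s by (simp add: divide_right_mono)
  qed
  ultimately have "\<bar>exp (- (q / (2 * \<sigma>\<^sup>2))) - exp (- (?r\<^sup>2 / (2 * \<sigma>\<^sup>2)))\<bar>
      \<le> \<bar>- (q / (2 * \<sigma>\<^sup>2)) - - (?r\<^sup>2 / (2 * \<sigma>\<^sup>2))\<bar> * exp ?m"
    by (rule abs_exp_diff_le)
  also have "\<bar>- (q / (2 * \<sigma>\<^sup>2)) - - (?r\<^sup>2 / (2 * \<sigma>\<^sup>2))\<bar> = \<bar>q - ?r\<^sup>2\<bar> / (2 * \<sigma>\<^sup>2)"
    by (simp add: abs_minus_commute flip: diff_divide_distrib)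
  also have "\<dots> * exp ?m \<le> 2 * (\<bar>t\<bar> * (1 + ?r)) / (2 * \<sigma>\<^sup>2) * exp ?m"
    using dq by (intro mult_right_mono divide_right_mono) auto
  also have "\<dots> = \<bar>t\<bar> * (exp (1 / (2 * \<sigma>\<^sup>2)) / \<sigma>\<^sup>2 * (1 + ?r) * exp (- (1 / (4 * \<sigma>\<^sup>2) * ?r\<^sup>2)))"
  proof -
    have "2 * (a * b) / (2 * S) * (E * F) = a * (E / S * b * F)" for a b S E F :: real by simp
    then show ?thesis by (simp only: exp_add)
  qed
  finally show ?thesis unfolding q_def gauss_weight_def .
qed

lemma lborel_integral_translate:
  fixes f :: "'a::euclidean_space \<Rightarrow> real"
  assumes [measurable]: "f \<in> borel_measurable borel"
  shows "(\<integral>y. f (y + a) \<partial>lborel) = (\<integral>y. f y \<partial>lborel)"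
    and "integrable lborel (\<lambda>y. f (y + a)) \<longleftrightarrow> integrable lborel f"
proof -
  have "(\<integral>y. f y \<partial>distr lborel borel ((+) a)) = (\<integral>y. f (a + y) \<partial>lborel)"
    by (rule integral_distr) auto
  then show "(\<integral>y. f (y + a) \<partial>lborel) = (\<integral>y. f y \<partial>lborel)"
    by (simp add: lborel_distr_plus add.commute)
  have "integrable (distr lborel borel ((+) a)) f \<longleftrightarrow> integrable lborel (\<lambda>y. f (a + y))"
    by (rule integrable_distr_eq) auto
  then show "integrable lborel (\<lambda>y. f (y + a)) \<longleftrightarrow> integrable lborel f"
    by (simp add: lborel_distr_plus add.commute)
qed

text \<open>Lipschitz functions grow linearly, so their products with a coordinate are covered by this
  bound.\<close>
lemma integrable_gauss_weight_quadratic_growth: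
  fixes h :: "'a::euclidean_space \<Rightarrow> real"
  assumes [measurable]: "h \<in> borel_measurable borel" and \<sigma>: "0 < \<sigma>"
    and bound: "\<And>y. \<bar>h y\<bar> \<le> K * (1 + norm (y - \<mu>))\<^sup>2"
  shows "integrable lborel (\<lambda>y. gauss_weight \<mu> \<sigma> y * h y)"
proof (rule integrable_of_Gaussian_tail)
  show "0 < 1 / (2 * \<sigma>\<^sup>2)" using \<sigma> by simp
  show "\<bar>gauss_weight \<mu> \<sigma> y * h y\<bar>
      \<le> K * (1 + norm (y - \<mu>))\<^sup>2 * exp (- (1 / (2 * \<sigma>\<^sup>2) * (norm (y - \<mu>))\<^sup>2))" for y
    using mult_right_mono[OF bound[of y] exp_ge_zero[of "- ((norm (y - \<mu>))\<^sup>2 / (2 * \<sigma>\<^sup>2))"]]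
    by (simp add: gauss_weight_def abs_mult mult.commute)
qed measurable

lemma lipschitz_linear_growth:
  fixes g :: "'a::real_normed_vector \<Rightarrow> real"
  assumes "L-lipschitz_on UNIV g"
  shows "\<bar>g y\<bar> \<le> (\<bar>g \<mu>\<bar> + L) * (1 + norm (y - \<mu>))"
proof -
  have "\<bar>g y - g \<mu>\<bar> \<le> L * norm (y - \<mu>)"
    using lipschitz_onD[OF assms, of y \<mu>] by (simp add: dist_norm)
  then have "\<bar>g y\<bar> \<le> \<bar>g \<mu>\<bar> + L * norm (y - \<mu>)" by linarith
  also have "\<dots> \<le> (\<bar>g \<mu>\<bar> + L) * (1 + norm (y - \<mu>))"
    using lipschitz_on_nonneg[OF assms] by (simp add: algebra_simps)
  finally show ?thesis .
qed

lemma lipschitz_borel_measurable: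
  fixes g :: "'a::real_normed_vector \<Rightarrow> real"
  assumes "L-lipschitz_on UNIV g"
  shows "g \<in> borel_measurable borel"
  using lipschitz_on_continuous_on[OF assms] by (rule borel_measurable_continuous_onI)

lemma integrable_gauss_weight_lipschitz:
  fixes g :: "'a::euclidean_space \<Rightarrow> real"
  assumes lip: "L-lipschitz_on UNIV g" and \<sigma>: "0 < \<sigma>"
  shows "integrable lborel (\<lambda>y. gauss_weight \<mu> \<sigma> y * g y)"
    and "norm e = 1 \<Longrightarrow> integrable lborel (\<lambda>y. gauss_weight \<mu> \<sigma> y * (g y * ((y - \<mu>) \<bullet> e)))"
proof -
  note [measurable] = lipschitz_borel_measurable[OF lip]
  let ?K = "\<bar>g \<mu>\<bar> + L"
  have K: "0 \<le> ?K" using lipschitz_on_nonneg[OF lip] by simp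
  have g: "\<bar>g y\<bar> \<le> ?K * (1 + norm (y - \<mu>))" for y by (rule lipschitz_linear_growth[OF lip])
  have sq: "?K * (1 + norm (y - \<mu>)) * (1 + norm (y - \<mu>)) = ?K * (1 + norm (y - \<mu>))\<^sup>2" for y
    by (simp add: power2_eq_square)
  show "integrable lborel (\<lambda>y. gauss_weight \<mu> \<sigma> y * g y)"
  proof (rule integrable_gauss_weight_quadratic_growth[OF _ \<sigma>])
    fix y
    have "?K * (1 + norm (y - \<mu>)) * 1 \<le> ?K * (1 + norm (y - \<mu>)) * (1 + norm (y - \<mu>))"
      using K by (intro mult_left_mono) auto
    then show "\<bar>g y\<bar> \<le> ?K * (1 + norm (y - \<mu>))\<^sup>2" using g[of y] unfolding sq by simp
  qed measurable
  assume e: "norm e = 1"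
  show "integrable lborel (\<lambda>y. gauss_weight \<mu> \<sigma> y * (g y * ((y - \<mu>) \<bullet> e)))"
  proof (rule integrable_gauss_weight_quadratic_growth[OF _ \<sigma>])
    fix y
    have "\<bar>(y - \<mu>) \<bullet> e\<bar> \<le> 1 + norm (y - \<mu>)"
      using Cauchy_Schwarz_ineq2[of "y - \<mu>" e] e by simp
    then have "\<bar>g y\<bar> * \<bar>(y - \<mu>) \<bullet> e\<bar> \<le> ?K * (1 + norm (y - \<mu>)) * (1 + norm (y - \<mu>))"
      using g[of y] K by (intro mult_mono) auto
    then show "\<bar>g y * ((y - \<mu>) \<bullet> e)\<bar> \<le> ?K * (1 + norm (y - \<mu>))\<^sup>2"
      unfolding sq abs_mult .
  qed measurable
qed

lemma DERIV_difference_quotient_LIMSEQ: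
  assumes "(f has_real_derivative D) (at 0)"
  shows "(\<lambda>k. (f (1 / real (Suc k)) - f 0) / (1 / real (Suc k))) \<longlonglongrightarrow> D"
proof -
  have "((\<lambda>h. (f h - f 0) / h) \<longlongrightarrow> D) (at 0)"
    using assms by (simp add: DERIV_def)
  moreover have "filterlim (\<lambda>k. 1 / real (Suc k)) (at 0) sequentially"
    using LIMSEQ_Suc[OF lim_1_over_n] by (auto simp: filterlim_at)
  ultimately show ?thesis by (rule filterlim_compose)
qed

lemma gauss_weight_has_real_derivative:
  fixes y \<mu> e :: "'a::euclidean_space"
  assumes "norm e = 1" "0 < \<sigma>"
  shows "((\<lambda>t. gauss_weight \<mu> \<sigma> (y - t *\<^sub>R e)) has_real_derivative
    gauss_weight \<mu> \<sigma> y * ((y - \<mu>) \<bullet> e) / \<sigma>\<^sup>2) (at 0)"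
proof -
  have "e \<bullet> e = 1" using assms by (simp add: norm_eq_1)
  then have "(norm (y - t *\<^sub>R e - \<mu>))\<^sup>2 = (norm (y - \<mu>))\<^sup>2 - 2 * t * ((y - \<mu>) \<bullet> e) + t\<^sup>2" for t
    unfolding power2_norm_eq_inner
    by (simp add: inner_diff_left inner_diff_right inner_commute power2_eq_square algebra_simps)
  then have *: "gauss_weight \<mu> \<sigma> (y - t *\<^sub>R e)
      = exp (- (((norm (y - \<mu>))\<^sup>2 - 2 * t * ((y - \<mu>) \<bullet> e) + t\<^sup>2) / (2 * \<sigma>\<^sup>2)))" for t
    by (simp add: gauss_weight_def)
  show ?thesis
    unfolding * using assms
    by (auto intro!: derivative_eq_intros simp: gauss_weight_def divide_simps)
qed

text \<open>For every step \<open>t\<close>, the translation \<open>y \<mapsto> y + t e\<close> shows that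
  \<open>\<integral> w y * (g (y + t e) - g y) / t = \<integral> g y * (w (y - t e) - w y) / t\<close>.
  The Lipschitz bound dominates the left integrand and the shift bound dominates the right one, so
  \<open>t \<rightarrow> 0\<close> may be taken inside both integrals. The derivative of \<open>t \<mapsto> w (y - t e)\<close> at 0 is
  \<open>w y * ((y - \<mu>) \<bullet> e) / \<sigma>\<^sup>2\<close>.\<close>
lemma Stein_identity_lipschitz:
  fixes g d :: "'a::euclidean_space \<Rightarrow> real"
  assumes lip: "L-lipschitz_on UNIV g" and e: "norm e = 1" and \<sigma>: "0 < \<sigma>"
    and d_meas [measurable]: "d \<in> borel_measurable borel"
    and der: "AE y in lborel. ((\<lambda>t. g (y + t *\<^sub>R e)) has_real_derivative d y) (at 0)"
  shows "integrable lborel (\<lambda>y. gauss_weight \<mu> \<sigma> y * d y)"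
    and "(\<integral>y. gauss_weight \<mu> \<sigma> y * (g y * ((y - \<mu>) \<bullet> e)) \<partial>lborel)
       = \<sigma>\<^sup>2 * (\<integral>y. gauss_weight \<mu> \<sigma> y * d y \<partial>lborel)"
proof -
  note [measurable] = lipschitz_borel_measurable[OF lip]
  let ?w = "gauss_weight \<mu> \<sigma>"
  define t :: "nat \<Rightarrow> real" where "t k = 1 / real (Suc k)" for k
  have t: "0 < t k" "t k \<le> 1" for k by (auto simp: t_def)
  define A where "A k y = ?w y * ((g (y + t k *\<^sub>R e) - g y) / t k)" for k y
  define B where "B k y = g y * ((?w (y - t k *\<^sub>R e) - ?w y) / t k)" for k y
  have [measurable]: "A k \<in> borel_measurable borel" "B k \<in> borel_measurable borel" for k
    unfolding A_def B_def by measurable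

  have A_bound: "norm (A k y) \<le> L * ?w y" for k y
  proof -
    have "\<bar>g (y + t k *\<^sub>R e) - g y\<bar> \<le> L * t k"
      using lipschitz_onD[OF lip, of "y + t k *\<^sub>R e" y] e t(1)[of k] by (simp add: dist_norm)
    then have "\<bar>(g (y + t k *\<^sub>R e) - g y) / t k\<bar> \<le> L"
      using t(1)[of k] by (simp add: divide_le_eq)
    then have "?w y * \<bar>(g (y + t k *\<^sub>R e) - g y) / t k\<bar> \<le> ?w y * L"
      by (intro mult_left_mono) (auto simp: gauss_weight_def)
    then show ?thesis by (simp add: A_def abs_mult gauss_weight_def mult.commute)
  qed
  have w_int: "integrable lborel (\<lambda>y. L * ?w y)"
    using integrable_gauss_weight_lipschitz(1)[of 0 "\<lambda>_. L" \<sigma> \<mu>] \<sigma>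
    by (simp add: lipschitz_on_def mult.commute)
  have A_lim: "AE y in lborel. (\<lambda>k. A k y) \<longlonglongrightarrow> ?w y * d y"
    using der
  proof eventually_elim
    fix y assume "((\<lambda>t. g (y + t *\<^sub>R e)) has_real_derivative d y) (at 0)"
    from DERIV_difference_quotient_LIMSEQ[OF this]
    show "(\<lambda>k. A k y) \<longlonglongrightarrow> ?w y * d y"
      unfolding A_def t_def by (intro tendsto_mult_left) simp
  qed
  show "integrable lborel (\<lambda>y. ?w y * d y)"
    by (rule integrable_dominated_convergence[OF _ _ w_int A_lim]) (use A_bound in auto)
  have A_conv: "(\<lambda>k. integral\<^sup>L lborel (A k)) \<longlonglongrightarrow> (\<integral>y. ?w y * d y \<partial>lborel)"
    by (rule integral_dominated_convergence[OF _ _ w_int A_lim]) (use A_bound in auto)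

  define K where "K = (\<bar>g \<mu>\<bar> + L) * (exp (1 / (2 * \<sigma>\<^sup>2)) / \<sigma>\<^sup>2)"
  define H where "H y = K * (1 + norm (y - \<mu>))\<^sup>2 * exp (- (1 / (4 * \<sigma>\<^sup>2) * (norm (y - \<mu>))\<^sup>2))" for y
  have K: "0 \<le> K" using lipschitz_on_nonneg[OF lip] by (simp add: K_def)
  have H_meas [measurable]: "H \<in> borel_measurable borel" unfolding H_def by measurable
  have H_int: "integrable lborel H"
    by (rule integrable_of_Gaussian_tail[where c = "1 / (4 * \<sigma>\<^sup>2)" and K = K and \<mu> = \<mu>])
       (use \<sigma> K in \<open>auto simp: H_def abs_mult\<close>)
  have B_bound: "norm (B k y) \<le> H y" for k y
  proof -
    let ?r = "norm (y - \<mu>)"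
    have "\<bar>?w (y - t k *\<^sub>R e) - ?w y\<bar>
        \<le> \<bar>t k\<bar> * (exp (1 / (2 * \<sigma>\<^sup>2)) / \<sigma>\<^sup>2 * (1 + ?r) * exp (- (1 / (4 * \<sigma>\<^sup>2) * ?r\<^sup>2)))"
      using t[of k] by (intro gauss_weight_shift_bound e \<sigma>) auto
    then have "\<bar>(?w (y - t k *\<^sub>R e) - ?w y) / t k\<bar>
        \<le> exp (1 / (2 * \<sigma>\<^sup>2)) / \<sigma>\<^sup>2 * (1 + ?r) * exp (- (1 / (4 * \<sigma>\<^sup>2) * ?r\<^sup>2))"
      using t(1)[of k] by (simp add: divide_le_eq mult.commute)
    then have "\<bar>g y\<bar> * \<bar>(?w (y - t k *\<^sub>R e) - ?w y) / t k\<bar> \<le> (\<bar>g \<mu>\<bar> + L) * (1 + ?r) *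
        (exp (1 / (2 * \<sigma>\<^sup>2)) / \<sigma>\<^sup>2 * (1 + ?r) * exp (- (1 / (4 * \<sigma>\<^sup>2) * ?r\<^sup>2)))"
      using lipschitz_linear_growth[OF lip, of y \<mu>] lipschitz_on_nonneg[OF lip]
      by (intro mult_mono) auto
    also have "\<dots> = H y" by (simp add: H_def K_def power2_eq_square)
    finally show ?thesis unfolding B_def real_norm_def abs_mult .
  qed
  have B_lim: "(\<lambda>k. B k y) \<longlonglongrightarrow> ?w y * (g y * ((y - \<mu>) \<bullet> e)) / \<sigma>\<^sup>2" for y
  proof -
    have "(\<lambda>k. B k y) \<longlonglongrightarrow> g y * (?w y * ((y - \<mu>) \<bullet> e) / \<sigma>\<^sup>2)"
      using DERIV_difference_quotient_LIMSEQ[OF gauss_weight_has_real_derivative[OF e \<sigma>, of \<mu> y]]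
      unfolding B_def t_def by (intro tendsto_mult_left) simp
    then show ?thesis by (simp add: mult.left_commute)
  qed
  have B_int: "integrable lborel (B k)" for k
    by (rule Bochner_Integration.integrable_bound[OF H_int]) (use order_trans[OF B_bound abs_ge_self] in auto)
  have B_conv: "(\<lambda>k. integral\<^sup>L lborel (B k)) \<longlonglongrightarrow>
      (\<integral>y. ?w y * (g y * ((y - \<mu>) \<bullet> e)) / \<sigma>\<^sup>2 \<partial>lborel)"
    by (rule integral_dominated_convergence[OF _ _ H_int]) (use B_lim B_bound in auto)

  have "integral\<^sup>L lborel (A k) = integral\<^sup>L lborel (B k)" for k
  proof -
    \<comment> \<open>The shifted integrand of \<open>A k\<close>, so that \<open>F (y + t e) = w y * g (y + t e)\<close>.\<close>
    define F where "F z = ?w (z - t k *\<^sub>R e) * g z" for z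
    have [measurable]: "F \<in> borel_measurable borel" unfolding F_def by measurable
    have wg: "integrable lborel (\<lambda>y. ?w y * g y)" by (rule integrable_gauss_weight_lipschitz(1)[OF lip \<sigma>])
    have F: "F = (\<lambda>y. ?w y * g y + t k * B k y)"
      using t(1)[of k] by (auto simp: F_def B_def fun_eq_iff field_simps)
    have F_int: "integrable lborel F" unfolding F by (intro Bochner_Integration.integrable_add integrable_mult_right wg B_int)
    have A: "A k = (\<lambda>y. (F (y + t k *\<^sub>R e) - ?w y * g y) / t k)"
      by (simp add: A_def F_def fun_eq_iff algebra_simps diff_divide_distrib)
    have B: "B k = (\<lambda>y. (F y - ?w y * g y) / t k)"
      by (simp add: B_def F_def fun_eq_iff algebra_simps diff_divide_distrib)
    have "integral\<^sup>L lborel (A k) = ((\<integral>y. F (y + t k *\<^sub>R e) \<partial>lborel) - (\<integral>y. ?w y * g y \<partial>lborel)) / t k"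
      unfolding A using F_int wg by (simp add: lborel_integral_translate Bochner_Integration.integral_diff)
    also have "\<dots> = integral\<^sup>L lborel (B k)"
      unfolding B using F_int wg by (simp add: lborel_integral_translate Bochner_Integration.integral_diff)
    finally show ?thesis .
  qed
  then have "(\<integral>y. ?w y * (g y * ((y - \<mu>) \<bullet> e)) / \<sigma>\<^sup>2 \<partial>lborel) = (\<integral>y. ?w y * d y \<partial>lborel)"
    using LIMSEQ_unique[OF B_conv] A_conv by simp
  then show "(\<integral>y. ?w y * (g y * ((y - \<mu>) \<bullet> e)) \<partial>lborel) = \<sigma>\<^sup>2 * (\<integral>y. ?w y * d y \<partial>lborel)"
    using \<sigma> by (simp add: field_simps)
qed

section \<open>Null sets, completions and partial derivatives\<close>

text \<open>Where \<open>f\<close> and \<open>g\<close> differ, preimages under \<open>g\<close> are arbitrary subsets of a null set; the completion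
  makes those measurable.\<close>
lemma integrable_completion_AE_cong:
  fixes f g :: "'a \<Rightarrow> real"
  assumes f: "integrable M f" and eq: "AE x in M. f x = g x"
  shows "integrable (completion M) g" and "integral\<^sup>L (completion M) g = integral\<^sup>L M f"
proof -
  have fM [measurable]: "f \<in> borel_measurable M" using f by simp
  have fC: "f \<in> borel_measurable (completion M)" by (rule measurable_completion) simp
  obtain N where N: "N \<in> null_sets M" "{x \<in> space M. f x \<noteq> g x} \<subseteq> N"
    using eq by (auto elim!: AE_E simp: null_sets_def)
  have gC: "g \<in> borel_measurable (completion M)"
  proof (rule measurableI)
    fix A :: "real set" assume A: "A \<in> sets borel"
    have split: "g -` A \<inter> space M = (f -` A \<inter> space M - N) \<union> (g -` A \<inter> space M \<inter> N)"
      using N(2) by auto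
    have good: "f -` A \<inter> space M - N \<in> sets (completion M)"
      using A N(1) fM by (intro sets_completionI_sets sets.Diff measurable_sets) auto
    have null: "g -` A \<inter> space M \<inter> N \<in> sets (completion M)"
      by (rule null_sets_completion[OF N(1)]) auto
    show "g -` A \<inter> space (completion M) \<in> sets (completion M)"
      unfolding space_completion by (subst split) (rule sets.Un[OF good null])
  qed simp
  have eqC: "AE x in completion M. f x = g x" by (rule AE_completion[OF eq])
  have "integrable (completion M) f" using f by (simp add: integrable_completion)
  then show "integrable (completion M) g"
    using integrable_cong_AE[OF fC gC eqC] by simp
  show "integral\<^sup>L (completion M) g = integral\<^sup>L M f"
    using integral_cong_AE[OF fC gC eqC] integral_completion[OF fM] by simp
qed

lemma AE_lborel_not_in_closed_negligible:
  assumes "closed Z" "negligible Z"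
  shows "AE y in lborel. y \<notin> Z"
proof (rule AE_not_in)
  have "Z \<in> sets lborel" using assms(1) by simp
  then show "Z \<in> null_sets lborel"
    using assms(2) by (simp add: negligible_iff_null_sets null_sets_completion_iff)
qed

lemma has_derivative_imp_partial_derivative:
  fixes f :: "real^'n \<Rightarrow> real^'k"
  assumes "(f has_derivative L) (at y)"
  shows "((\<lambda>t. f (y + t *\<^sub>R e) $ i) has_real_derivative L e $ i) (at 0)"
proof -
  interpret L: bounded_linear L using assms by (rule has_derivative_bounded_linear)
  have "((\<lambda>t. y + t *\<^sub>R e) has_derivative (\<lambda>t. t *\<^sub>R e)) (at 0)"
    by (auto intro!: derivative_eq_intros)
  then have "((\<lambda>t. f (y + t *\<^sub>R e)) has_derivative (\<lambda>t. L (t *\<^sub>R e))) (at 0)"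
    by (rule has_derivative_compose[where g = f]) (simp add: assms)
  then have "((\<lambda>t. f (y + t *\<^sub>R e) $ i) has_derivative (\<lambda>t. L (t *\<^sub>R e) $ i)) (at 0)"
    by (rule bounded_linear.has_derivative[OF bounded_linear_vec_nth])
  moreover have "(\<lambda>t. L (t *\<^sub>R e) $ i) = (*) (L e $ i)" by (simp add: fun_eq_iff L.scaleR)
  ultimately show ?thesis by (simp only: has_field_derivative_def)
qed

lemma lipschitz_vec_nth:
  fixes f :: "'b::metric_space \<Rightarrow> real^'n"
  assumes "L-lipschitz_on S f"
  shows "L-lipschitz_on S (\<lambda>y. f y $ i - c)"
proof (rule lipschitz_onI)
  fix x y assume "x \<in> S" "y \<in> S"
  have "dist (f x $ i - c) (f y $ i - c) \<le> dist (f x) (f y)"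
    using component_le_norm_cart[of "f x - f y" i] by (simp add: dist_norm)
  also have "\<dots> \<le> L * dist x y" using assms \<open>x \<in> S\<close> \<open>y \<in> S\<close> by (rule lipschitz_onD)
  finally show "dist (f x $ i - c) (f y $ i - c) \<le> L * dist x y" .
qed (rule lipschitz_on_nonneg[OF assms])

section \<open>Covariances under an isotropic normal law\<close>

lemma isotropic_normal_density_eq_gauss_weight:
  fixes \<mu> :: "real^'n"
  shows "isotropic_normal_density \<mu> \<sigma> y = (1 / sqrt (2 * pi * \<sigma>\<^sup>2)) ^ CARD('n) * gauss_weight \<mu> \<sigma> y"
proof -
  have "(norm (y - \<mu>))\<^sup>2 = (\<Sum>i\<in>UNIV. (y $ i - \<mu> $ i)\<^sup>2)"
    unfolding power2_norm_eq_inner inner_vec_def by (simp add: power2_eq_square)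
  then have "- ((norm (y - \<mu>))\<^sup>2 / (2 * \<sigma>\<^sup>2)) = (\<Sum>i\<in>UNIV. - (y $ i - \<mu> $ i)\<^sup>2 / (2 * \<sigma>\<^sup>2))"
    by (simp add: sum_negf sum_divide_distrib)
  then show ?thesis
    unfolding isotropic_normal_density_def normal_density_def gauss_weight_def
    by (simp add: prod.distrib exp_sum prod_dividef power_one_over)
qed

lemma isotropic_normal_transfer:
  fixes Y :: "'a \<Rightarrow> real^'n" and h :: "real^'n \<Rightarrow> real"
  assumes Y: "distributed M lborel Y (\<lambda>y. ennreal (isotropic_normal_density \<mu> \<sigma> y))"
    and \<sigma>: "0 < \<sigma>" and h: "h \<in> borel_measurable borel"
    and int: "integrable lborel (\<lambda>y. gauss_weight \<mu> \<sigma> y * h y)"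
  shows "integrable M (\<lambda>\<omega>. h (Y \<omega>))"
    and "(\<integral>\<omega>. h (Y \<omega>) \<partial>M)
      = (1 / sqrt (2 * pi * \<sigma>\<^sup>2)) ^ CARD('n) * (\<integral>y. gauss_weight \<mu> \<sigma> y * h y \<partial>lborel)"
proof -
  have nn: "0 \<le> isotropic_normal_density \<mu> \<sigma> y" for y
    unfolding isotropic_normal_density_def by (intro prod_nonneg) simp
  have h': "h \<in> borel_measurable lborel" using h by simp
  have "integrable lborel (\<lambda>y. isotropic_normal_density \<mu> \<sigma> y * h y)"
    unfolding isotropic_normal_density_eq_gauss_weight mult.assoc by (intro integrable_mult_right int)
  then show "integrable M (\<lambda>\<omega>. h (Y \<omega>))"
    using distributed_integrable[OF Y h' nn] by simp
  show "(\<integral>\<omega>. h (Y \<omega>) \<partial>M)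
      = (1 / sqrt (2 * pi * \<sigma>\<^sup>2)) ^ CARD('n) * (\<integral>y. gauss_weight \<mu> \<sigma> y * h y \<partial>lborel)"
    using distributed_integral[OF Y h' nn]
    unfolding isotropic_normal_density_eq_gauss_weight mult.assoc by simp
qed

text \<open>Stein's identity with \<open>g = 1\<close> shows that \<open>Y\<^sub>i\<close> has mean \<open>\<mu>\<^sub>i\<close>; applied to \<open>g - E (g Y)\<close> it then
  gives the covariance. The Lipschitz hypothesis is stated for all vertical shifts of \<open>g\<close> to make
  the second application immediate.\<close>
lemma Stein_covariance:
  fixes Y :: "'a \<Rightarrow> real^'n" and g d :: "real^'n \<Rightarrow> real"
  assumes M: "prob_space M"
    and Y: "distributed M lborel Y (\<lambda>y. ennreal (isotropic_normal_density \<mu> \<sigma> y))"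
    and \<sigma>: "0 < \<sigma>"
    and lip: "\<And>c. L-lipschitz_on UNIV (\<lambda>y. g y - c)"
    and d: "d \<in> borel_measurable borel"
    and der: "AE y in lborel. ((\<lambda>t. g (y + t *\<^sub>R axis i 1)) has_real_derivative d y) (at 0)"
  shows "integrable M (\<lambda>\<omega>. g (Y \<omega>))"
    and "integrable M (\<lambda>\<omega>. g (Y \<omega>) * Y \<omega> $ i)"
    and "integrable M (\<lambda>\<omega>. d (Y \<omega>))"
    and "covariance M (\<lambda>\<omega>. g (Y \<omega>)) (\<lambda>\<omega>. Y \<omega> $ i) = \<sigma>\<^sup>2 * (\<integral>\<omega>. d (Y \<omega>) \<partial>M)"
proof -
  interpret prob_space M by (rule M)
  let ?e = "axis i 1 :: real^'n"
  have e: "norm ?e = 1" by simp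
  have ip: "(y - \<mu>) \<bullet> ?e = y $ i - \<mu> $ i" for y by (simp add: inner_axis)
  have lip0: "L-lipschitz_on UNIV g" using lip[of 0] by simp
  note [measurable] = lipschitz_borel_measurable[OF lip0] d
  note transfer = isotropic_normal_transfer[OF Y \<sigma>]
  show g: "integrable M (\<lambda>\<omega>. g (Y \<omega>))"
    by (rule transfer(1)[OF _ integrable_gauss_weight_lipschitz(1)[OF lip0 \<sigma>]]) measurable
  have "integrable M (\<lambda>\<omega>. g (Y \<omega>) * ((Y \<omega> - \<mu>) \<bullet> ?e))"
    by (rule transfer(1)[OF _ integrable_gauss_weight_lipschitz(2)[OF lip0 \<sigma> e]]) measurable
  then have "integrable M (\<lambda>\<omega>. g (Y \<omega>) * ((Y \<omega> - \<mu>) \<bullet> ?e) + g (Y \<omega>) * \<mu> $ i)"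
    using g by (intro Bochner_Integration.integrable_add integrable_mult_left) auto
  then show "integrable M (\<lambda>\<omega>. g (Y \<omega>) * Y \<omega> $ i)"
    unfolding ip by (simp add: algebra_simps)

  have one: "1-lipschitz_on UNIV (\<lambda>y::real^'n. 1::real)" by (simp add: lipschitz_on_def)
  have zero: "AE y in lborel. ((\<lambda>t. 1) has_real_derivative 0) (at 0)" by simp
  have c_int: "integrable M (\<lambda>\<omega>. 1 * ((Y \<omega> - \<mu>) \<bullet> ?e))"
    by (rule transfer(1)[OF _ integrable_gauss_weight_lipschitz(2)[OF one \<sigma> e]]) measurable
  have "(\<integral>\<omega>. 1 * ((Y \<omega> - \<mu>) \<bullet> ?e) \<partial>M) = 0"
    using transfer(2)[OF _ integrable_gauss_weight_lipschitz(2)[OF one \<sigma> e]]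
      Stein_identity_lipschitz(2)[OF one e \<sigma> _ zero, of \<mu>] by simp
  then have "(\<integral>\<omega>. ((Y \<omega> - \<mu>) \<bullet> ?e + \<mu> $ i) \<partial>M) = \<mu> $ i"
    using c_int by (subst Bochner_Integration.integral_add) (auto simp: prob_space)
  then have mean: "(\<integral>\<omega>. Y \<omega> $ i \<partial>M) = \<mu> $ i" by (simp add: ip)

  define m where "m = (\<integral>\<omega>. g (Y \<omega>) \<partial>M)"
  have der': "AE y in lborel. ((\<lambda>t. g (y + t *\<^sub>R ?e) - m) has_real_derivative d y) (at 0)"
    using der by eventually_elim (auto intro!: derivative_eq_intros)
  note Stein = Stein_identity_lipschitz[OF lip e \<sigma> d der', where \<mu> = \<mu>]
  show "integrable M (\<lambda>\<omega>. d (Y \<omega>))" by (rule transfer(1)[OF d Stein(1)])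
  have "covariance M (\<lambda>\<omega>. g (Y \<omega>)) (\<lambda>\<omega>. Y \<omega> $ i) = (\<integral>\<omega>. (g (Y \<omega>) - m) * ((Y \<omega> - \<mu>) \<bullet> ?e) \<partial>M)"
    by (simp add: covariance_def mean ip m_def)
  also have "\<dots> = \<sigma>\<^sup>2 * (\<integral>\<omega>. d (Y \<omega>) \<partial>M)"
    using transfer(2)[OF _ integrable_gauss_weight_lipschitz(2)[OF lip[of m] \<sigma> e]]
      Stein(2) transfer(2)[OF d Stein(1)] by simp
  finally show "covariance M (\<lambda>\<omega>. g (Y \<omega>)) (\<lambda>\<omega>. Y \<omega> $ i) = \<sigma>\<^sup>2 * (\<integral>\<omega>. d (Y \<omega>) \<partial>M)" .
qed

section \<open>Degrees of freedom of the signal approximator\<close>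

theorem theorem1:
  fixes D :: "real^'n^'m" and M :: "'a measure" and Y :: "'a \<Rightarrow> real^'n"
    and \<mu> :: "real^'n" and \<sigma> lam :: real and uhat :: "real^'n \<Rightarrow> real^'m"
  assumes "prob_space M"
    and "distributed M lborel Y (\<lambda>y. ennreal (isotropic_normal_density \<mu> \<sigma> y))"
    and "0 < \<sigma>"
    and "0 \<le> lam"
    and "\<And>y. dual_solution D lam y (uhat y)"
  shows "(\<forall>i. integrable M (\<lambda>\<omega>. signal_approx D lam (Y \<omega>) $ i)
            \<and> integrable M (\<lambda>\<omega>. signal_approx D lam (Y \<omega>) $ i * Y \<omega> $ i))
    \<and> integrable (completion M)
        (\<lambda>\<omega>. real (nullity_minus D (boundary_set lam (uhat (Y \<omega>)))))
    \<and> degrees_of_freedom M Y \<sigma> (signal_approx D lam)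
        = (\<integral>\<omega>. real (nullity_minus D (boundary_set lam (uhat (Y \<omega>)))) \<partial>(completion M))
    \<and> (AE y in lborel. \<forall>u v. dual_solution D lam y u \<longrightarrow> dual_solution D lam y v \<longrightarrow>
          null_space_minus D (boundary_set lam u) = null_space_minus D (boundary_set lam v))"
proof -
  let ?f = "signal_approx D lam"
  let ?N = "\<lambda>u. null_space_minus D (boundary_set lam u)"
  obtain Z where Z: "closed Z" "negligible Z"
    and deriv: "\<And>y u. y \<notin> Z \<Longrightarrow> dual_solution D lam y u \<Longrightarrow> (?f has_derivative orth_proj (?N u)) (at y)"
    by (rule signal_approx_locally_projection[OF assms(4)]) (rule that)
  have AE_Z: "AE y in lborel. y \<notin> Z" by (rule AE_lborel_not_in_closed_negligible[OF Z])
  have unique: "AE y in lborel. \<forall>u v. dual_solution D lam y u \<longrightarrow> dual_solution D lam y v \<longrightarrow> ?N u = ?N v"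
    using AE_Z
  proof (eventually_elim, intro allI impI)
    fix y u v assume "y \<notin> Z" "dual_solution D lam y u" "dual_solution D lam y v"
    then have "orth_proj (?N u) = orth_proj (?N v)"
      using deriv by (blast intro: has_derivative_unique)
    then show "?N u = ?N v"
      using range_orth_proj[OF subspace_null_space_minus] by metis
  qed

  have lip: "1-lipschitz_on UNIV (\<lambda>y. ?f y $ i - c)" for i c
    by (rule lipschitz_vec_nth[OF signal_approx_lipschitz[OF assms(4)]])
  have f_meas [measurable]: "(\<lambda>y. ?f y $ i) \<in> borel_measurable borel" for i
    using lipschitz_borel_measurable[OF lip[of i 0]] by simp
  \<comment> \<open>A limit of difference quotients, so that measurability holds by construction; off \<open>Z\<close> it is the partial derivative.\<close>
  define d where "d i y = lim (\<lambda>k. (?f (y + (1 / real (Suc k)) *\<^sub>R axis i 1) $ i - ?f y $ i) / (1 / real (Suc k)))" for i y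
  have [measurable]: "d i \<in> borel_measurable borel" for i
  proof -
    have "(\<lambda>y. ?f (y + (1 / real (Suc k)) *\<^sub>R axis i 1) $ i) \<in> borel_measurable borel" for k
      by (rule measurable_compose[OF _ f_meas]) measurable
    then show ?thesis unfolding d_def by measurable
  qed
  have d_eq: "d i y = orth_proj (?N (uhat y)) (axis i 1) $ i"
    and d_der: "((\<lambda>t. ?f (y + t *\<^sub>R axis i 1) $ i) has_real_derivative d i y) (at 0)" if "y \<notin> Z" for i y
  proof -
    have D: "((\<lambda>t. ?f (y + t *\<^sub>R axis i 1) $ i) has_real_derivative orth_proj (?N (uhat y)) (axis i 1) $ i) (at 0)"
      by (rule has_derivative_imp_partial_derivative[OF deriv[OF that assms(5)]])
    show "d i y = orth_proj (?N (uhat y)) (axis i 1) $ i"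
      using limI[OF DERIV_difference_quotient_LIMSEQ[OF D]] by (simp add: d_def)
    with D show "((\<lambda>t. ?f (y + t *\<^sub>R axis i 1) $ i) has_real_derivative d i y) (at 0)" by simp
  qed
  have der: "AE y in lborel. ((\<lambda>t. ?f (y + t *\<^sub>R axis i 1) $ i) has_real_derivative d i y) (at 0)" for i
    using AE_Z by eventually_elim (rule d_der)
  note Stein = Stein_covariance[OF assms(1-3) lip _ der]

  have "AE y in distr M lborel Y. y \<notin> Z"
    unfolding distributed_distr_eq_density[OF assms(2)]
    using AE_Z distributed_borel_measurable[OF assms(2)] by (subst AE_density) auto
  then have "AE \<omega> in M. Y \<omega> \<notin> Z"
    using distributed_measurable[OF assms(2)] by (rule AE_distrD[rotated])
  then have div: "AE \<omega> in M. (\<Sum>i\<in>UNIV. d i (Y \<omega>)) = real (nullity_minus D (boundary_set lam (uhat (Y \<omega>))))"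
    by eventually_elim
      (simp add: d_eq trace_orth_proj_cart[OF subspace_null_space_minus] nullity_minus_def)
  have div_int: "integrable M (\<lambda>\<omega>. \<Sum>i\<in>UNIV. d i (Y \<omega>))"
    by (intro Bochner_Integration.integrable_sum Stein(3)) measurable
  \<comment> \<open>Each covariance is \<open>\<sigma>\<^sup>2\<close> times the mean of a partial derivative, so the factor \<open>1 / \<sigma>\<^sup>2\<close> cancels.\<close>
  have "degrees_of_freedom M Y \<sigma> ?f = (\<Sum>i\<in>UNIV. \<integral>\<omega>. d i (Y \<omega>) \<partial>M)"
    using assms(3) by (simp add: degrees_of_freedom_def Stein(4) flip: sum_distrib_left)
  also have "\<dots> = (\<integral>\<omega>. (\<Sum>i\<in>UNIV. d i (Y \<omega>)) \<partial>M)"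
    by (rule Bochner_Integration.integral_sum[symmetric]) (rule Stein(3), measurable)
  also have "\<dots> = (\<integral>\<omega>. real (nullity_minus D (boundary_set lam (uhat (Y \<omega>)))) \<partial>(completion M))"
    by (rule integrable_completion_AE_cong(2)[OF div_int div, symmetric])
  finally have df: "degrees_of_freedom M Y \<sigma> ?f
      = (\<integral>\<omega>. real (nullity_minus D (boundary_set lam (uhat (Y \<omega>)))) \<partial>(completion M))" .
  show ?thesis
    using Stein(1,2) integrable_completion_AE_cong(1)[OF div_int div] df unique by simp
qed

end
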